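(* Let $r\geq 3$ be a fixed integer. Then for large $n$, $$B(K(n,r))\le \binom{n}{r} - \frac{1}{2}\binom{n-1}{r-1} - 2\frac{n^{r-2}}{(r-2)!} + (r+2)\frac{n^{r-3}}{(r-3)!} + O(n^{r-4}),$$ where the implied constant in $O(n^{r-4})$ may depend on $r$ but not on $n$.
   Context: For a graph $G=(V,E)$ on $N$ vertices and a bijection $f:V\to\{1,\dots,N\}$, let $\mathrm{dilation}(f)=\max\{|f(v)-f(w)| : vw\in E\}$; the bandwidth $B(G)$ is the minimum of $\mathrm{dilation}(f)$ over all such bijections. The Kneser graph $K(n,r)$ has as vertex set the family of all $r$-element subsets of $[n]=\{1,\dots,n\}$, two vertices being adjacent iff the corresponding $r$-sets are disjoint. *)

theory Defs
  imports Complex_Main "HOL-Library.Landau_Symbols"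
begin

text \<open>
  A finite simple graph is given by its vertex set \<open>V\<close> and its set \<open>E\<close> of edges, an edge
  \<open>vw\<close> being the two-element set \<open>{v, w}\<close>.
\<close>

text \<open>
  The inserted \<open>0\<close> only matters for edgeless graphs, whose dilation is thereby \<open>0\<close>.
\<close>

definition dilation :: "'a set set \<Rightarrow> ('a \<Rightarrow> nat) \<Rightarrow> nat" where
  "dilation E f = Max (insert 0 {nat \<bar>int (f v) - int (f w)\<bar> | v w. {v, w} \<in> E})"

text \<open>
  For finite \<open>V\<close> the set below is a nonempty set of natural numbers, so that \<open>Inf\<close> is its minimum.
\<close>

definition bandwidth :: "'a set \<Rightarrow> 'a set set \<Rightarrow> nat" where
  "bandwidth V E = Inf {dilation E f | f. bij_betw f V {1..card V}}"

definition kneser_verts :: "nat \<Rightarrow> nat \<Rightarrow> nat set set" where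
  "kneser_verts n r = {A. A \<subseteq> {1..n} \<and> card A = r}"

definition kneser_edges :: "nat \<Rightarrow> nat \<Rightarrow> nat set set set" where
  "kneser_edges n r =
     {{A, B} | A B. A \<in> kneser_verts n r \<and> B \<in> kneser_verts n r \<and> A \<inter> B = {}}"

end

theory Submission
  imports Defs "HOL-Library.FuncSet"
begin

text \<open>
  The dilation of a labelling of \<open>N\<close> vertices is at most \<open>N - (M + 1)\<close> as soon as the \<open>i\<close>-th vertex
  and the \<open>j\<close>-th vertex from the end are nonadjacent whenever \<open>i + j \<le> M + 1\<close>. To make \<open>M\<close> large, put
  half of the sets containing \<open>1\<close> at each end: these never conflict. Each end can then be extended
  inwards by \<open>m\<close> sets avoiding \<open>1\<close>, provided that the \<open>j\<close>-th of them meets the first \<open>m + 1 - j\<close> sets at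
  the opposite end. To leading order one starts the left end with the sets containing \<open>{1, 2}\<close>,
  then \<open>{1, 3}\<close>, and extends the right end by the sets containing \<open>{2, 3}\<close>, then \<open>{2}\<close>; the other pair
  of ends uses \<open>4, 5\<close> instead of \<open>2, 3\<close>. The two constructions compete for the sets that contain \<open>1\<close>
  and meet both \<open>{2, 3}\<close> and \<open>{4, 5}\<close>; sharing these costs each side about \<open>2 n^(r-3) / (r-3)!\<close>
  sets, which are regained by appending sets containing \<open>{1, 6, 7}\<close> and then \<open>{1, 6}\<close>, and by
  putting the sets containing \<open>{2, 3, 6}\<close> and \<open>{2, 3, 7}\<close> first in the extension. Thus
  \<open>M = h + m\<close> with \<open>h = (n-1 choose r-1) div 2\<close> and
  \<open>m = (n-3 choose r-2) + (n-4 choose r-2) + 2 (n-8 choose r-3)\<close>.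
\<close>

section \<open>Bandwidth bounds from nonadjacent ends\<close>

text \<open>\<open>Rs\<close> is listed from the outside in, so \<open>Rs ! j\<close> has exactly
  \<open>j\<close> vertices after it. An edge with label difference at least \<open>N - m\<close>
  would join some \<open>Ls ! i\<close> to some \<open>Rs ! j\<close> with
  \<open>i + j < m\<close>.\<close>

lemma bandwidth_le_if_ends_nonadjacent:
  assumes V: "finite V"
    and edges: "\<And>v w. {v, w} \<in> E \<Longrightarrow> v \<in> V \<and> w \<in> V"
    and dist: "distinct (Ls @ Rs)" and sub: "set (Ls @ Rs) \<subseteq> V"
    and len: "length Ls = m" "length Rs = m"
    and nonadj: "\<And>i j. i + j < m \<Longrightarrow> {Ls ! i, Rs ! j} \<notin> E"
  shows "bandwidth V E \<le> card V - Suc m"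
proof -
  obtain Ms where Ms: "set Ms = V - set (Ls @ Rs)" "distinct Ms"
    using finite_distinct_list V by (metis finite_Diff)
  define xs where "xs = Ls @ Ms @ rev Rs"
  have dxs: "distinct xs" and sxs: "set xs = V"
    using dist sub Ms by (auto simp: xs_def)
  define N where "N = card V"
  have N: "length xs = N"
    using dxs sxs N_def distinct_card by metis
  have N2: "2 * m \<le> N"
    using N len by (simp add: xs_def)
  have bij0: "bij_betw ((!) xs) {..<N} V"
    using dxs sxs N by (auto intro!: bij_betw_nth)
  define pos where "pos = the_inv_into {..<N} ((!) xs)"
  have pos: "bij_betw pos V {..<N}"
    unfolding pos_def by (rule bij_betw_the_inv_into[OF bij0])
  have nth_pos: "pos v < N" "xs ! pos v = v" if "v \<in> V" for v
  proof -
    show "pos v < N" using pos that by (auto dest: bij_betwE)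
    show "xs ! pos v = v" unfolding pos_def
      using f_the_inv_into_f[of "(!) xs" "{..<N}" v] bij0 that by (auto simp: bij_betw_def)
  qed
  have bij: "bij_betw (Suc \<circ> pos) V {1..card V}"
  proof (rule bij_betw_trans[OF pos])
    show "bij_betw Suc {..<N} {1..card V}"
      unfolding bij_betw_def N_def
      by (simp add: image_Suc_lessThan)
  qed
  have aux: "pos w < pos v + (N - m)" if "{v, w} \<in> E" for v w
  proof (rule ccontr)
    assume c: "\<not> ?thesis"
    have vw: "v \<in> V" "w \<in> V" using edges[OF that] by auto
    define j where "j = N - Suc (pos w)"
    have lt: "pos w < N" using nth_pos vw by auto
    have sum: "pos v + j < m" using c lt N2 unfolding j_def by linarith
    then have "xs ! pos v = Ls ! pos v"
      using len by (simp add: xs_def nth_append)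
    moreover have "rev xs ! j = xs ! pos w"
      using lt N by (simp add: rev_nth j_def Suc_diff_Suc)
    moreover have "rev xs ! j = Rs ! j"
      using sum len by (simp add: xs_def nth_append)
    ultimately have "{Ls ! pos v, Rs ! j} = {v, w}"
      using nth_pos vw by simp
    then show False using nonadj[OF sum] that by simp
  qed
  have diff: "nat \<bar>int (Suc (pos v)) - int (Suc (pos w))\<bar> \<le> N - Suc m" if "{v, w} \<in> E" for v w
    using aux[OF that] aux[of w v] that N2 by (simp add: insert_commute)
  let ?D = "{nat \<bar>int ((Suc \<circ> pos) v) - int ((Suc \<circ> pos) w)\<bar> | v w. {v, w} \<in> E}"
  have "?D \<subseteq> {..N - Suc m}"
    using diff by auto
  then have "dilation E (Suc \<circ> pos) \<le> N - Suc m"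
    unfolding dilation_def by (subst Max_le_iff) (auto dest: finite_subset)
  moreover have "bandwidth V E \<le> dilation E (Suc \<circ> pos)"
    unfolding bandwidth_def by (rule cInf_lower) (use bij in auto)
  ultimately show ?thesis by (simp add: N_def)
qed

section \<open>Kneser graphs and blocks of r-sets\<close>

lemma finite_kneser_verts [simp]: "finite (kneser_verts n r)"
  unfolding kneser_verts_def by (rule finite_subset[of _ "Pow {1..n}"]) auto

lemma card_kneser_verts: "card (kneser_verts n r) = n choose r"
  unfolding kneser_verts_def by (simp add: n_subsets)

lemma kneser_edges_iff:
  "{A, B} \<in> kneser_edges n r \<longleftrightarrow> A \<in> kneser_verts n r \<and> B \<in> kneser_verts n r \<and> A \<inter> B = {}"
  unfolding kneser_edges_def by (auto simp: doubleton_eq_iff)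

definition block :: "nat \<Rightarrow> nat \<Rightarrow> nat set \<Rightarrow> nat set \<Rightarrow> nat set set" where
  "block n r I J = {A \<in> kneser_verts n r. I \<subseteq> A \<and> A \<inter> J = {}}"

lemma finite_block [simp]: "finite (block n r I J)"
  unfolding block_def by simp

lemma card_block:
  assumes "I \<subseteq> {1..n}" "J \<subseteq> {1..n}" "I \<inter> J = {}" "card I \<le> r"
  shows "card (block n r I J) = (n - card I - card J) choose (r - card I)"
proof -
  let ?U = "{1..n} - I - J"
  have fin: "finite I" "finite J" using assms finite_subset by blast+
  have U: "card ?U = n - card I - card J"
  proof -
    have "card ?U = card ({1..n} - I) - card J"
      using assms fin by (intro card_Diff_subset) auto
    then show ?thesis using assms fin by (simp add: card_Diff_subset)
  qed
  have "bij_betw (\<lambda>B. I \<union> B) {B. B \<subseteq> ?U \<and> card B = r - card I} (block n r I J)"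
  proof (rule bij_betwI[where g = "\<lambda>A. A - I"])
    show "(\<lambda>B. I \<union> B) \<in> {B. B \<subseteq> ?U \<and> card B = r - card I} \<rightarrow> block n r I J"
    proof
      fix B assume "B \<in> {B. B \<subseteq> ?U \<and> card B = r - card I}"
      then have B: "B \<subseteq> ?U" "card B = r - card I" by auto
      have "finite B" using B(1) finite_subset by fastforce
      then have "card (I \<union> B) = card I + card B"
        using B fin by (intro card_Un_disjoint) auto
      then show "I \<union> B \<in> block n r I J"
        using B assms unfolding block_def kneser_verts_def by auto
    qed
    show "(\<lambda>A. A - I) \<in> block n r I J \<rightarrow> {B. B \<subseteq> ?U \<and> card B = r - card I}"
      using fin unfolding block_def kneser_verts_def by (auto simp: card_Diff_subset)
  qed (auto simp: block_def)
  from bij_betw_same_card[OF this] show ?thesis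
    using n_subsets[of ?U "r - card I"] U by simp
qed

section \<open>Opposite lists from rank functions\<close>

text \<open>After sorting by \<open>g\<close>, the elements of rank below \<open>k\<close> form an
  initial segment; comparing a position with its length gives both bounds.\<close>

lemma ex_distinct_list_sorted_by:
  fixes g :: "'a \<Rightarrow> nat"
  assumes "finite S"
  shows "\<exists>xs. distinct xs \<and> set xs = S \<and>
    (\<forall>i k. i < card {x \<in> S. g x < k} \<longrightarrow> g (xs ! i) < k) \<and>
    (\<forall>i<card S. card {x \<in> S. g x < g (xs ! i)} \<le> i)"
proof -
  obtain ys where ys: "set ys = S" "distinct ys"
    using finite_distinct_list assms by blast
  define xs where "xs = sort_key g ys"
  have xs: "distinct xs" "set xs = S" "sorted (map g xs)"
    using ys by (auto simp: xs_def)
  have len: "length xs = card S" using xs distinct_card by metis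
  have mono: "g (xs ! i) \<le> g (xs ! j)" if "i \<le> j" "j < card S" for i j
    using xs(3) that len by (auto simp: sorted_iff_nth_mono)
  have mem: "\<exists>j<card S. xs ! j = x" if "x \<in> S" for x
    using that xs(2) len by (metis in_set_conv_nth)
  have up: "card {x \<in> S. g x < k} \<le> i" if "k \<le> g (xs ! i)" "i < card S" for i k
  proof -
    have "{x \<in> S. g x < k} \<subseteq> (!) xs ` {..<i}"
    proof
      fix x assume "x \<in> {x \<in> S. g x < k}"
      then obtain j where "j < card S" "xs ! j = x" "g x < k" using mem by blast
      then show "x \<in> (!) xs ` {..<i}"
        using mono[of i j] that by (cases "i \<le> j") auto
    qed
    then have "card {x \<in> S. g x < k} \<le> card ((!) xs ` {..<i})"
      by (intro card_mono) auto
    also have "\<dots> \<le> i" using card_image_le[of "{..<i}" "(!) xs"] by simp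
    finally show ?thesis .
  qed
  have "g (xs ! i) < k" if "i < card {x \<in> S. g x < k}" for i k
  proof (rule ccontr)
    have "card {x \<in> S. g x < k} \<le> card S" using assms by (intro card_mono) auto
    moreover assume "\<not> ?thesis"
    ultimately show False using up[of k i] that by simp
  qed
  then show ?thesis using xs up by blast
qed

text \<open>List both families by increasing rank and let \<open>i + j < m\<close>. If
  \<open>xs ! i\<close> has rank \<open>k\<close>, at most \<open>i\<close> members of
  \<open>S\<close> rank lower, so by \<open>size\<close> more than \<open>j\<close> members of
  \<open>T\<close> have rank at most \<open>d - k\<close>. Then \<open>ys ! j\<close> is one of them
  and \<open>meet\<close> applies.\<close>

lemma staircase_lists:
  fixes g g' :: "'a set \<Rightarrow> nat"
  assumes fin: "finite S" "finite T"
    and rank: "\<And>A. A \<in> S \<Longrightarrow> g A \<le> d"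
    and size: "\<And>k. k \<le> Suc d \<Longrightarrow>
      m \<le> card {A \<in> S. g A < k} + card {B \<in> T. g' B + k < Suc d}"
    and meet: "\<And>A B. \<lbrakk>A \<in> S; B \<in> T; g A + g' B \<le> d\<rbrakk> \<Longrightarrow> A \<inter> B \<noteq> {}"
  shows "\<exists>P X. distinct P \<and> distinct X \<and> length P = m \<and> length X = m \<and> set P \<subseteq> S \<and> set X \<subseteq> T \<and>
    (\<forall>i j. i + j < m \<longrightarrow> P ! i \<inter> X ! j \<noteq> {})"
proof -
  obtain xs where xs: "distinct xs" "set xs = S"
    "\<And>i. i < card S \<Longrightarrow> card {A \<in> S. g A < g (xs ! i)} \<le> i"
    using ex_distinct_list_sorted_by[OF fin(1), of g] by blast
  obtain ys where ys: "distinct ys" "set ys = T"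
    "\<And>i k. i < card {B \<in> T. g' B < k} \<Longrightarrow> g' (ys ! i) < k"
    using ex_distinct_list_sorted_by[OF fin(2), of g'] by blast
  have len: "length xs = card S" "length ys = card T"
    using xs ys distinct_card by metis+
  \<comment> \<open>At \<open>k = 0\<close> and \<open>k = Suc d\<close> one of the counts in
    \<open>size\<close> vanishes, so each family alone has at least \<open>m\<close>
    members.\<close>
  have "card {B \<in> T. g' B + 0 < Suc d} \<le> card T" "card {A \<in> S. g A < Suc d} \<le> card S"
    using fin by (auto intro!: card_mono)
  then have m: "m \<le> card S" "m \<le> card T"
    using size[of 0] size[of "Suc d"] by auto
  have "xs ! i \<inter> ys ! j \<noteq> {}" if "i + j < m" for i j
  proof -
    have mem: "xs ! i \<in> S" "ys ! j \<in> T"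
      using xs(2) ys(2) len m that by (metis nth_mem add_lessD1 add.commute order_less_le_trans)+
    define k where "k = g (xs ! i)"
    have k: "k \<le> d" using rank mem k_def by simp
    have "card {A \<in> S. g A < k} \<le> i" using xs(3) that m k_def by simp
    then have "j < card {B \<in> T. g' B + k < Suc d}" using size[of k] that k by simp
    also have "{B \<in> T. g' B + k < Suc d} = {B \<in> T. g' B < Suc d - k}" by auto
    finally have "g' (ys ! j) < Suc d - k" by (rule ys(3))
    then show ?thesis using meet[OF mem] k_def by simp
  qed
  then show ?thesis using xs ys m len
    by (intro exI[of _ "take m xs"] exI[of _ "take m ys"]) (auto dest: in_set_takeD)
qed

section \<open>Filling the ends with sets containing 1\<close>

lemma bandwidth_kneser_le:
  assumes dist: "distinct (P @ Q)" "distinct (X @ Y)"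
    and len: "length P = m" "length Q = m" "length X = m" "length Y = m"
    and P: "set P \<union> set Q \<subseteq> {A \<in> kneser_verts n r. 1 \<in> A}"
    and X: "set X \<union> set Y \<subseteq> {A \<in> kneser_verts n r. 1 \<notin> A}"
    and meet: "\<And>i j. i + j < m \<Longrightarrow> P ! i \<inter> X ! j \<noteq> {}"
      "\<And>i j. i + j < m \<Longrightarrow> Q ! i \<inter> Y ! j \<noteq> {}"
    and m: "2 * m \<le> (n - 1) choose (r - 1)" and r: "1 \<le> r" and n: "1 \<le> n"
  shows "bandwidth (kneser_verts n r) (kneser_edges n r)
    \<le> (n choose r) - Suc (((n - 1) choose (r - 1)) div 2 + m)"
proof -
  let ?V = "kneser_verts n r"
  define S where "S = {A \<in> ?V. 1 \<in> A}"
  define h where "h = ((n - 1) choose (r - 1)) div 2"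
  have "S = block n r {1} {}" by (auto simp: S_def block_def)
  then have cS: "card S = (n - 1) choose (r - 1)"
    using card_block[of "{1}" n "{}" r] r n by simp
  have finS: "finite S" by (simp add: S_def)
  have hm: "m \<le> h" using m h_def by simp
  have h2: "2 * h \<le> card S" unfolding cS h_def by simp
  let ?W = "S - set (P @ Q)"
  have "card ?W = card S - 2 * m"
    using dist(1) P finS len distinct_card[OF dist(1)]
    by (subst card_Diff_subset) (auto simp: S_def)
  moreover obtain ws where ws: "set ws = ?W" "distinct ws"
    using finite_distinct_list finS by (metis finite_Diff)
  ultimately have lws: "length ws = card S - 2 * m" using distinct_card by metis
  \<comment> \<open>Padding up to length \<open>h\<close>. Its order is irrelevant: the extensions
    \<open>X\<close> and \<open>Y\<close> are only compared with \<open>P\<close> and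
    \<open>Q\<close>.\<close>
  define W1 where "W1 = take (h - m) ws"
  define W2 where "W2 = take (h - m) (drop (h - m) ws)"
  have lw: "length W1 = h - m" "length W2 = h - m"
    unfolding W1_def W2_def length_take length_drop lws using h2 hm by linarith+
  have "distinct (take (h - m) ws @ drop (h - m) ws)" using ws by simp
  then have dw: "distinct (W1 @ W2)"
    unfolding W1_def W2_def distinct_append by (auto dest: in_set_takeD)
  have sw: "set W1 \<subseteq> ?W" "set W2 \<subseteq> ?W"
    using ws by (auto simp: W1_def W2_def dest: in_set_takeD in_set_dropD)
  define L R where "L = P @ W1" and "R = Q @ W2"
  have LR: "set L \<subseteq> S" "set R \<subseteq> S" "length L = h" "length R = h"
    using P sw lw len hm by (auto simp: L_def R_def S_def)
  have "bandwidth ?V (kneser_edges n r) \<le> card ?V - Suc (h + m)"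
  \<comment> \<open>The extensions are crossed: \<open>X\<close> lies at the right end and so faces
    \<open>P\<close>, while \<open>Y\<close> faces \<open>Q\<close>.\<close>
  proof (rule bandwidth_le_if_ends_nonadjacent[where Ls = "L @ Y" and Rs = "R @ X"])
    have "set L \<inter> set R = {}" "distinct L" "distinct R"
      using dist(1) dw sw by (auto simp: L_def R_def)
    moreover have "S \<inter> (set X \<union> set Y) = {}" using X by (auto simp: S_def)
    ultimately show "distinct ((L @ Y) @ R @ X)"
      using dist(2) LR by (simp add: Int_Un_distrib Int_Un_distrib2) blast
    show "set ((L @ Y) @ R @ X) \<subseteq> ?V"
      using LR X by (auto simp: S_def)
    show "{(L @ Y) ! i, (R @ X) ! j} \<notin> kneser_edges n r" if ij: "i + j < h + m" for i j
    proof -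
      have "(L @ Y) ! i \<inter> (R @ X) ! j \<noteq> {}"
      proof (cases "i < h \<and> j < h")
        case True
        then have "L ! i \<in> S" "R ! j \<in> S" using LR by (metis nth_mem subsetD)+
        then show ?thesis using True LR by (auto simp: nth_append S_def)
      next
        case False
        \<comment> \<open>Beyond position \<open>h\<close> at one end, \<open>i + j < h + m\<close>
          forces the other index below \<open>m\<close>, hence into \<open>P\<close> or
          \<open>Q\<close>.\<close>
        then consider "h \<le> j" | "h \<le> i" by linarith
        then show ?thesis
        proof cases
          case 1
          then have "i < m" "i + (j - h) < m" using ij by auto
          then show ?thesis
            using meet(1)[of i "j - h"] 1 LR hm len by (auto simp: nth_append L_def)
        next
          case 2
          then have "j < m" "j + (i - h) < m" using ij by auto
          then show ?thesis
            using meet(2)[of j "i - h"] 2 LR hm len by (auto simp: nth_append R_def)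
        qed
      qed
      then show ?thesis by (simp add: kneser_edges_iff)
    qed
  qed (use LR len in \<open>auto simp: kneser_edges_iff\<close>)
  then show ?thesis by (simp add: card_kneser_verts h_def)
qed

section \<open>The explicit families with five ranks\<close>

lemma card_add_le:
  assumes "finite Z" "A \<subseteq> Z" "B \<subseteq> Z" "A \<inter> B = {}"
  shows "card A + card B \<le> card Z"
proof -
  have "card A + card B = card (A \<union> B)"
    using assms finite_subset by (metis card_Un_disjoint)
  also have "\<dots> \<le> card Z" using assms by (intro card_mono) auto
  finally show ?thesis .
qed

lemma card_add3_le:
  assumes "finite Z" "A \<subseteq> Z" "B \<subseteq> Z" "C \<subseteq> Z" "A \<inter> B = {}" "A \<inter> C = {}" "B \<inter> C = {}"
  shows "card A + card B + card C \<le> card Z"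
proof -
  have "card A + card B = card (A \<union> B)"
    using assms finite_subset by (metis card_Un_disjoint)
  then show ?thesis using card_add_le[of Z "A \<union> B" C] assms by (simp add: Int_Un_distrib2)
qed

text \<open>
  The case \<open>(u, a, b, c, d, p, q, e) = (1, 2, 3, 4, 5, 6, 7, 8)\<close> serves one pair of ends and
  \<open>(1, 4, 5, 3, 2, 8, 9, 6)\<close> the other; the conditions on \<open>P\<close> and \<open>X\<close> are such that these two
  instances are disjoint.
\<close>

lemma kneser_staircase:
  assumes dist: "distinct [u, a, b, c, d, p, q, e]" and sub: "{u, a, b, c, d, p, q, e} \<subseteq> {1..n}"
    and r: "3 \<le> r"
    and growth: "2 * ((n - 8) choose (r - 3)) \<le> (n - 7) choose (r - 2)"
      "((n - 3) choose (r - 2)) + ((n - 8) choose (r - 3)) \<le> (n - 4) choose (r - 1)"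
    and m: "m = ((n - 3) choose (r - 2)) + ((n - 4) choose (r - 2)) + 2 * ((n - 8) choose (r - 3))"
  shows "\<exists>P X. distinct P \<and> distinct X \<and> length P = m \<and> length X = m \<and>
    set P \<subseteq> {A \<in> kneser_verts n r. u \<in> A \<and> (a \<in> A \<and> d \<notin> A \<or> b \<in> A \<and> a \<notin> A \<and> c \<notin> A \<or>
      p \<in> A \<and> A \<inter> {a, b, c, d, e} = {})} \<and>
    set X \<subseteq> {B \<in> kneser_verts n r. u \<notin> B \<and> a \<in> B \<and>
      (b \<in> B \<and> \<not> {c, d} \<subseteq> B \<or> b \<notin> B \<and> c \<notin> B)} \<and>
    (\<forall>i j. i + j < m \<longrightarrow> P ! i \<inter> X ! j \<noteq> {})"
    (is "\<exists>P X. _ P X \<and> _ X \<and> _ P \<and> _ X \<and> set P \<subseteq> ?S \<and> set X \<subseteq> ?T \<and> _")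
proof -
  define S where "S = ?S"
  define T where "T = ?T"
  \<comment> \<open>At ranks 0 to 4, members of \<open>S\<close> contain \<open>a\<close>;
    \<open>b, p\<close>; \<open>b\<close>; \<open>p, q\<close>; \<open>p\<close> respectively.
    Members of \<open>T\<close> all contain \<open>a\<close>, and at ranks 0 to 4 also
    \<open>b, p\<close>; \<open>b, q\<close>; \<open>b\<close>; \<open>p\<close>; nothing more.
    Whenever the ranks sum to at most 4, a common element is left.\<close>
  define g :: "nat set \<Rightarrow> nat" where
    "g A = (if a \<in> A then 0 else if b \<in> A then if p \<in> A then 1 else 2 else if q \<in> A then 3 else 4)" for A
  define g' :: "nat set \<Rightarrow> nat" where
    "g' B = (if b \<in> B then if p \<in> B then 0 else if q \<in> B then 1 else 2 else if p \<in> B then 3 else 4)" for B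
  have fin: "finite S" "finite T" by (simp_all add: S_def T_def)
  note cb = card_block[of _ n _ r]
  have cA: "card (block n r {u, a} {d}) = (n - 3) choose (r - 2)"
    and cBp: "card (block n r {u, b, p} {a, c}) = (n - 5) choose (r - 3)"
    and cB: "card (block n r {u, b} {a, c}) = (n - 4) choose (r - 2)"
    and cZ1: "card (block n r {u, p, q} {a, b, c, d, e}) = (n - 8) choose (r - 3)"
    and cZ: "card (block n r {u, p} {a, b, c, d, e}) = (n - 7) choose (r - 2)"
    and cXp: "card (block n r {a, b, p} {u, c}) = (n - 5) choose (r - 3)"
    and cXq: "card (block n r {a, b, q} {u, c, p}) = (n - 6) choose (r - 3)"
    and cX1: "card (block n r {a, b} {u, c}) = (n - 4) choose (r - 2)"
    and cX2: "card (block n r {a, b, c} {u, d}) = (n - 5) choose (r - 3)"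
    and cY1: "card (block n r {a, p} {u, b, c}) = (n - 5) choose (r - 2)"
    and cY: "card (block n r {a} {u, b, c}) = (n - 4) choose (r - 1)"
    using dist sub r by (subst cb; simp add: eval_nat_numeral)+
  have le58: "(n - 8) choose k \<le> (n - 5) choose k" and le68: "(n - 8) choose k \<le> (n - 6) choose k"
    and le75: "(n - 7) choose k \<le> (n - 5) choose k"
    for k by (simp_all add: binomial_right_mono)
  have S1: "((n - 3) choose (r - 2))
      \<le> card {A \<in> S. g A < 1}"
    unfolding cA[symmetric]
    by (intro card_mono) (use fin in simp, auto simp: block_def S_def g_def)
  have S2: "((n - 3) choose (r - 2)) + ((n - 5) choose (r - 3))
      \<le> card {A \<in> S. g A < 2}"
    unfolding cA[symmetric] cBp[symmetric]
    by (intro card_add_le) (use fin in simp, auto simp: block_def S_def g_def)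
  have S3: "((n - 3) choose (r - 2)) + ((n - 4) choose (r - 2))
      \<le> card {A \<in> S. g A < 3}"
    unfolding cA[symmetric] cB[symmetric]
    by (intro card_add_le) (use fin in simp, auto simp: block_def S_def g_def)
  have S4: "((n - 3) choose (r - 2)) + ((n - 4) choose (r - 2)) + ((n - 8) choose (r - 3))
      \<le> card {A \<in> S. g A < 4}"
    unfolding cA[symmetric] cB[symmetric] cZ1[symmetric]
    by (intro card_add3_le) (use fin in simp, auto simp: block_def S_def g_def)
  have S5: "((n - 3) choose (r - 2)) + ((n - 4) choose (r - 2)) + ((n - 7) choose (r - 2))
      \<le> card {A \<in> S. g A < 5}"
    unfolding cA[symmetric] cB[symmetric] cZ[symmetric]
    by (intro card_add3_le) (use fin in simp, auto simp: block_def S_def g_def)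
  have T1: "((n - 5) choose (r - 3))
      \<le> card {A \<in> T. g' A < 1}"
    unfolding cXp[symmetric]
    by (intro card_mono) (use fin in simp, auto simp: block_def T_def g'_def)
  have T2: "((n - 5) choose (r - 3)) + ((n - 6) choose (r - 3))
      \<le> card {A \<in> T. g' A < 2}"
    unfolding cXp[symmetric] cXq[symmetric]
    by (intro card_add_le) (use fin in simp, auto simp: block_def T_def g'_def)
  \<comment> \<open>Members of \<open>T\<close> that contain \<open>b\<close> lack \<open>c\<close>
    or \<open>d\<close>; splitting by whether \<open>c\<close> belongs to them gives two
    blocks.\<close>
  have T3: "((n - 4) choose (r - 2)) + ((n - 5) choose (r - 3))
      \<le> card {A \<in> T. g' A < 3}"
    unfolding cX1[symmetric] cX2[symmetric]
    by (intro card_add_le) (use fin in simp, auto simp: block_def T_def g'_def)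
  have T4: "((n - 4) choose (r - 2)) + ((n - 5) choose (r - 3)) + ((n - 5) choose (r - 2))
      \<le> card {A \<in> T. g' A < 4}"
    unfolding cX1[symmetric] cX2[symmetric] cY1[symmetric]
    by (intro card_add3_le) (use fin in simp, auto simp: block_def T_def g'_def)
  have T5: "((n - 4) choose (r - 2)) + ((n - 5) choose (r - 3)) + ((n - 4) choose (r - 1))
      \<le> card {A \<in> T. g' A < 5}"
    unfolding cX1[symmetric] cX2[symmetric] cY[symmetric]
    by (intro card_add3_le) (use fin in simp, auto simp: block_def T_def g'_def)
  have "\<exists>P X. distinct P \<and> distinct X \<and> length P = m \<and> length X = m \<and> set P \<subseteq> S \<and> set X \<subseteq> T \<and>
    (\<forall>i j. i + j < m \<longrightarrow> P ! i \<inter> X ! j \<noteq> {})"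
  proof (rule staircase_lists[where g = g and g' = g' and d = 4])
    fix k :: nat assume k: "k \<le> Suc 4"
    have eq: "{B \<in> T. g' B + k < Suc 4} = {B \<in> T. g' B < 5 - k}" using k by auto
    \<comment> \<open>The tight values are \<open>k = 2, 3, 4\<close>: beyond the two main terms
      only two binomials with lower index \<open>r - 3\<close> are available. The remaining
      \<open>k\<close> have room by \<open>growth\<close>.\<close>
    from k consider "k = 0" | "k = 1" | "k = 2" | "k = 3" | "k = 4" | "k = 5" by linarith
    then show "m \<le> card {A \<in> S. g A < k} + card {B \<in> T. g' B + k < Suc 4}"
      unfolding eq
    proof cases
      case 1 then show "m \<le> card {A \<in> S. g A < k} + card {B \<in> T. g' B < 5 - k}"
        using T5 growth(2) le58[of "r - 3"] m by simp
    next
      case 2 then show "m \<le> card {A \<in> S. g A < k} + card {B \<in> T. g' B < 5 - k}"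
        using S1 T4 growth(1) le58[of "r - 3"] le75[of "r - 2"] m by simp
    next
      case 3 then show "m \<le> card {A \<in> S. g A < k} + card {B \<in> T. g' B < 5 - k}"
        using S2 T3 le58[of "r - 3"] m by simp
    next
      case 4 then show "m \<le> card {A \<in> S. g A < k} + card {B \<in> T. g' B < 5 - k}"
        using S3 T2 le58[of "r - 3"] le68[of "r - 3"] m by simp
    next
      case 5 then show "m \<le> card {A \<in> S. g A < k} + card {B \<in> T. g' B < 5 - k}"
        using S4 T1 le58[of "r - 3"] m by simp
    next
      case 6 then show "m \<le> card {A \<in> S. g A < k} + card {B \<in> T. g' B < 5 - k}"
        using S5 growth(1) m by simp
    qed
  next
    fix A B assume "A \<in> S" "B \<in> T" "g A + g' B \<le> 4"
    then show "A \<inter> B \<noteq> {}"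
      by (auto simp: S_def T_def g_def g'_def split: if_splits)
  qed (use fin in \<open>auto simp: g_def\<close>)
  then show ?thesis unfolding S_def T_def .
qed

section \<open>Growth and asymptotics of binomials\<close>

text \<open>Consecutive binomials have ratio \<open>(n - k) / (k + 1)\<close>, which the assumption
  makes at least \<open>t\<close>.\<close>

lemma mult_binomial_le_binomial_Suc:
  assumes "k + t * Suc k \<le> n"
  shows "t * (n choose k) \<le> n choose Suc k"
proof -
  have "Suc k * (t * (n choose k)) \<le> (n - k) * (n choose k)"
    unfolding mult.assoc[symmetric] using assms by (intro mult_right_mono) (auto simp: algebra_simps)
  also have "\<dots> = Suc k * (n choose Suc k)"
    using binomial_absorb_comp[of n k] binomial_absorption[of k n]
    by simp
  finally show ?thesis unfolding mult_le_cancel1 by blast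
qed

text \<open>By induction on the number of factors, keeping the two leading terms. Integer exponents
  cover \<open>m = 0\<close> and \<open>m = 1\<close>, where \<open>m - 2\<close> is
  negative.\<close>

lemma prod_diff_bigo:
  fixes a :: "nat \<Rightarrow> real"
  shows "(\<lambda>n. (\<Prod>j<m. real n - a j) - (real n ^ m - (\<Sum>j<m. a j) * real n powi (int m - 1)))
    \<in> O(\<lambda>n. real n powi (int m - 2))"
proof (induction m)
  case 0
  then show ?case by simp
next
  case (Suc m)
  define err where
    "err n = (\<Prod>j<m. real n - a j) - (real n ^ m - (\<Sum>j<m. a j) * real n powi (int m - 1))" for n :: nat
  let ?F = "\<lambda>n::nat. real n powi (int m - 1)"
  have "(\<lambda>n. real n - a m) \<in> O(\<lambda>n. real n)"
  proof (rule sum_in_bigo)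
    show "(\<lambda>_. a m) \<in> O(\<lambda>n. real n)"
      by (rule bigoI[of _ "\<bar>a m\<bar>"], rule eventually_mono[OF eventually_ge_at_top[of 1]])
        (simp add: mult_le_cancel_left1)
  qed simp
  then have "(\<lambda>n. err n * (real n - a m)) \<in> O(\<lambda>n. real n powi (int m - 2) * real n)"
    using Suc unfolding err_def by (intro landau_o.big.mult)
  also have "(\<lambda>n. real n powi (int m - 2) * real n) \<in> \<Theta>(?F)"
    by (intro bigthetaI_cong eventually_mono[OF eventually_gt_at_top[of 0]])
      (simp add: power_int_diff power2_eq_square)
  finally have "(\<lambda>n. err n * (real n - a m)) \<in> O(?F)" .
  then have *: "(\<lambda>n. err n * (real n - a m) + a m * (\<Sum>j<m. a j) * ?F n) \<in> O(?F)"
    by (intro sum_in_bigo) auto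
  have "\<forall>\<^sub>F n in sequentially. (\<Prod>j<Suc m. real n - a j) - (real n ^ Suc m -
      (\<Sum>j<Suc m. a j) * real n powi (int (Suc m) - 1))
    = err n * (real n - a m) + a m * (\<Sum>j<m. a j) * ?F n"
  \<comment> \<open>Positivity matters: for \<open>m = 0\<close> and \<open>n = 0\<close> the left
    side of the next identity is \<open>0 ^ 0 = 1\<close>, the right side 0.\<close>
  proof (rule eventually_mono[OF eventually_gt_at_top[of 0]])
    fix n :: nat assume n: "0 < n"
    have "real n ^ m = ?F n * real n"
      using n by (simp add: power_int_diff)
    then show "(\<Prod>j<Suc m. real n - a j) - (real n ^ Suc m -
        (\<Sum>j<Suc m. a j) * real n powi (int (Suc m) - 1))
      = err n * (real n - a m) + a m * (\<Sum>j<m. a j) * ?F n"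
      by (simp add: err_def algebra_simps)
  qed
  from landau_o.big.in_cong[OF this] * show ?case by simp
qed

text \<open>For \<open>k \<le> n\<close> the binomial is the product of \<open>n - (k + j)\<close>
  over \<open>j < m\<close>, divided by \<open>fact m\<close>; the second coefficient is the sum of
  these shifts.\<close>

lemma binomial_diff_bigo:
  "(\<lambda>n. real ((n - k) choose m) -
      (real n ^ m - (real m * real k + real m * (real m - 1) / 2) * real n powi (int m - 1)) / fact m)
    \<in> O(\<lambda>n. real n powi (int m - 2))"
proof -
  have sum: "(\<Sum>j<m. real k + real j) = real m * real k + real m * (real m - 1) / 2"
    by (induction m) (simp_all add: field_simps)
  have "(\<lambda>n. 1 / fact m * ((\<Prod>j<m. real n - (real k + real j)) -
      (real n ^ m - (\<Sum>j<m. real k + real j) * real n powi (int m - 1))))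
    \<in> O(\<lambda>n. real n powi (int m - 2))"
    using prod_diff_bigo[of "\<lambda>j. real k + real j" m] by simp
  moreover have "\<forall>\<^sub>F n in sequentially. real ((n - k) choose m) -
      (real n ^ m - (real m * real k + real m * (real m - 1) / 2) * real n powi (int m - 1)) / fact m
    = 1 / fact m * ((\<Prod>j<m. real n - (real k + real j)) -
      (real n ^ m - (\<Sum>j<m. real k + real j) * real n powi (int m - 1)))"
  proof (rule eventually_mono[OF eventually_ge_at_top[of k]])
    fix n assume "k \<le> n"
    then have "real ((n - k) choose m) = (\<Prod>j<m. real n - (real k + real j)) / fact m"
      by (simp add: binomial_gbinomial gbinomial_prod_rev of_nat_diff lessThan_atLeast0 algebra_simps)
    then show "real ((n - k) choose m) -
      (real n ^ m - (real m * real k + real m * (real m - 1) / 2) * real n powi (int m - 1)) / fact m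
    = 1 / fact m * ((\<Prod>j<m. real n - (real k + real j)) -
      (real n ^ m - (\<Sum>j<m. real k + real j) * real n powi (int m - 1)))"
      by (simp add: sum diff_divide_distrib)
  qed
  ultimately show ?thesis using landau_o.big.in_cong by fast
qed

lemma binomial_diff_bigo':
  "(\<lambda>n. real ((n - k) choose m) - real n ^ m / fact m) \<in> O(\<lambda>n. real n powi (int m - 1))"
proof -
  define C where "C = (real m * real k + real m * (real m - 1) / 2) / fact m"
  let ?F = "\<lambda>n::nat. real n powi (int m - 1)"
  have "(\<lambda>n. real n powi (int m - 2)) \<in> O(?F)"
  proof (rule landau_o.big_mono, rule eventually_mono[OF eventually_gt_at_top[of 0]])
    show "norm (real n powi (int m - 2)) \<le> norm (?F n)" if "0 < n" for n
      using that by (auto intro!: power_int_increasing)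
  qed
  from landau_o.big.trans[OF binomial_diff_bigo this, of k]
  have "(\<lambda>n. real ((n - k) choose m) -
      (real n ^ m - (real m * real k + real m * (real m - 1) / 2) * ?F n) / fact m) \<in> O(?F)" .
  moreover have "(\<lambda>n. (- C) * ?F n) \<in> O(?F)" by simp
  ultimately have "(\<lambda>n. (real ((n - k) choose m) -
      (real n ^ m - (real m * real k + real m * (real m - 1) / 2) * ?F n) / fact m) + (- C) * ?F n) \<in> O(?F)"
    by (rule sum_in_bigo)
  also have "(\<lambda>n. (real ((n - k) choose m) -
      (real n ^ m - (real m * real k + real m * (real m - 1) / 2) * ?F n) / fact m) + (- C) * ?F n) =
    (\<lambda>n. real ((n - k) choose m) - real n ^ m / fact m)"
    by (simp add: C_def diff_divide_distrib fun_eq_iff)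
  finally show ?thesis .
qed

text \<open>This is the \<open>m\<close> of \<open>kneser_staircase\<close> for
  \<open>r = q + 3\<close>.\<close>

definition staircase_length :: "nat \<Rightarrow> nat \<Rightarrow> nat" where
  "staircase_length q n = ((n - 3) choose Suc q) + ((n - 4) choose Suc q) + 2 * ((n - 8) choose q)"

text \<open>In units of \<open>n ^ q / fact q\<close>, the second coefficient of
  \<open>(n - k) choose Suc q\<close> is \<open>- (k + q / 2)\<close>. Together \<open>k = 3\<close>
  and \<open>k = 4\<close> give \<open>- (q + 7)\<close>, and \<open>2 * ((n - 8) choose q)\<close>
  adds 2, leaving \<open>- (q + 5)\<close>.\<close>

lemma staircase_length_bigo:
  "(\<lambda>n. 2 * (real n ^ Suc q / fact (Suc q)) - (real q + 5) * (real n ^ q / fact q) -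
      real (staircase_length q n))
    \<in> O(\<lambda>n. real n powi (int q - 1))"
proof -
  define e where "e k n = real ((n - k) choose Suc q) -
    (real n ^ Suc q - (real (Suc q) * real k + real (Suc q) * (real (Suc q) - 1) / 2) *
      real n powi (int (Suc q) - 1)) / fact (Suc q)" for k n
  define e' where "e' n = real ((n - 8) choose q) - real n ^ q / fact q" for n
  have e: "e k \<in> O(\<lambda>n. real n powi (int q - 1))" for k
    using binomial_diff_bigo[of k "Suc q"] unfolding e_def by simp
  have "e' \<in> O(\<lambda>n. real n powi (int q - 1))"
    using binomial_diff_bigo'[of 8 q] unfolding e'_def .
  then have "(\<lambda>n. - (e 3 n + e 4 n + 2 * e' n)) \<in> O(\<lambda>n. real n powi (int q - 1))"
    using e[of 3] e[of 4] by (simp add: sum_in_bigo)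
  also have "(\<lambda>n. - (e 3 n + e 4 n + 2 * e' n)) = (\<lambda>n. 2 * (real n ^ Suc q / fact (Suc q)) -
    (real q + 5) * (real n ^ q / fact q) -
    real (staircase_length q n))"
  proof
    fix n
    have eq: "e k n = real ((n - k) choose Suc q) - real n ^ Suc q / fact (Suc q)
      + (real k + real q / 2) * (real n ^ q / fact q)" for k
    proof -
      have "(real (Suc q) * real k + real (Suc q) * (real (Suc q) - 1) / 2) * real n ^ q / fact (Suc q)
        = (real (Suc q) * ((real k + real q / 2) * real n ^ q)) / (real (Suc q) * fact q)"
        by (simp add: field_simps)
      also have "\<dots> = (real k + real q / 2) * real n ^ q / fact q"
        by (subst mult_divide_mult_cancel_left) auto
      finally show ?thesis by (simp add: e_def diff_divide_distrib)
    qed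
    show "- (e 3 n + e 4 n + 2 * e' n) = 2 * (real n ^ Suc q / fact (Suc q)) -
      (real q + 5) * (real n ^ q / fact q) -
      real (staircase_length q n)"
      unfolding eq e'_def by (simp add: staircase_length_def algebra_simps add_divide_distrib)
  qed
  finally show ?thesis .
qed

section \<open>The bound for large n\<close>

text \<open>The threshold on \<open>n\<close> is generous: the strongest growth condition, with
  factor 8 in \<open>gr3\<close>, asks for \<open>9 * q + 18 \<le> n\<close>.\<close>

lemma bandwidth_kneser_staircase:
  assumes n: "12 * q + 60 \<le> n"
  shows "bandwidth (kneser_verts n (q + 3)) (kneser_edges n (q + 3)) +
      Suc (((n - 1) choose (q + 2)) div 2 + staircase_length q n) \<le> n choose (q + 3)"
proof -
  let ?m = "staircase_length q n"
  have "2 * ((n - 8) choose q) \<le> (n - 8) choose Suc q"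
    using n by (intro mult_binomial_le_binomial_Suc) auto
  also have "\<dots> \<le> (n - 7) choose Suc q" by (simp add: binomial_right_mono)
  finally have gr1: "2 * ((n - 8) choose q) \<le> (n - 7) choose Suc q" .
  have "(n - 3) choose Suc q = ((n - 4) choose Suc q) + ((n - 4) choose q)"
    using binomial_Suc_Suc[of "n - 4" q] n by (simp add: Suc_diff_Suc numeral_eq_Suc)
  moreover have "1 * ((n - 4) choose q) \<le> (n - 4) choose Suc q"
    "3 * ((n - 4) choose Suc q) \<le> (n - 4) choose Suc (Suc q)"
    using n by (intro mult_binomial_le_binomial_Suc; simp)+
  moreover have "(n - 8) choose q \<le> (n - 4) choose q" by (simp add: binomial_right_mono)
  ultimately have gr2: "((n - 3) choose Suc q) + ((n - 8) choose q) \<le> (n - 4) choose Suc (Suc q)"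
    by simp
  \<comment> \<open>Counted with multiplicity, \<open>?m\<close> has four binomials, each at most
    \<open>(n - 1) choose Suc q\<close>; hence the factor 8 for \<open>2 * ?m\<close>.\<close>
  have "(n - 3) choose Suc q \<le> (n - 1) choose Suc q" "(n - 4) choose Suc q \<le> (n - 1) choose Suc q"
    "(n - 8) choose q \<le> (n - 1) choose q"
    by (simp_all add: binomial_right_mono)
  moreover have "1 * ((n - 1) choose q) \<le> (n - 1) choose Suc q"
    "8 * ((n - 1) choose Suc q) \<le> (n - 1) choose Suc (Suc q)"
    using n by (intro mult_binomial_le_binomial_Suc; simp)+
  ultimately have gr3: "2 * ?m \<le> (n - 1) choose Suc (Suc q)"
    by (simp add: staircase_length_def)
  have m: "?m = ((n - 3) choose (q + 3 - 2)) + ((n - 4) choose (q + 3 - 2))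
      + 2 * ((n - 8) choose (q + 3 - 3))"
    by (simp add: staircase_length_def)
  have gr: "2 * ((n - 8) choose (q + 3 - 3)) \<le> (n - 7) choose (q + 3 - 2)"
    "((n - 3) choose (q + 3 - 2)) + ((n - 8) choose (q + 3 - 3)) \<le> (n - 4) choose (q + 3 - 1)"
    using gr1 gr2 by simp_all
  have dist: "distinct [1::nat, 2, 3, 4, 5, 6, 7, 8]" "distinct [1::nat, 4, 5, 3, 2, 8, 9, 6]"
    by simp_all
  have sub: "{1, 2, 3, 4, 5, 6, 7, 8} \<subseteq> {1..n}" "{1, 4, 5, 3, 2, 8, 9, 6} \<subseteq> {1..n}"
    using n by auto
  have q: "3 \<le> q + 3" by simp
  obtain P X where PX: "distinct P" "distinct X" "length P = ?m" "length X = ?m"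
    "set P \<subseteq> {A \<in> kneser_verts n (q + 3). 1 \<in> A \<and> (2 \<in> A \<and> 5 \<notin> A \<or> 3 \<in> A \<and> 2 \<notin> A \<and> 4 \<notin> A \<or>
      6 \<in> A \<and> A \<inter> {2, 3, 4, 5, 8} = {})}"
    "set X \<subseteq> {B \<in> kneser_verts n (q + 3). 1 \<notin> B \<and> 2 \<in> B \<and>
      (3 \<in> B \<and> \<not> {4, 5} \<subseteq> B \<or> 3 \<notin> B \<and> 4 \<notin> B)}"
    "\<And>i j. i + j < ?m \<Longrightarrow> P ! i \<inter> X ! j \<noteq> {}"
    using kneser_staircase[OF dist(1) sub(1) q gr m] by blast
  obtain Q Y where QY: "distinct Q" "distinct Y" "length Q = ?m" "length Y = ?m"
    "set Q \<subseteq> {A \<in> kneser_verts n (q + 3). 1 \<in> A \<and> (4 \<in> A \<and> 2 \<notin> A \<or> 5 \<in> A \<and> 4 \<notin> A \<and> 3 \<notin> A \<or>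
      8 \<in> A \<and> A \<inter> {4, 5, 3, 2, 6} = {})}"
    "set Y \<subseteq> {B \<in> kneser_verts n (q + 3). 1 \<notin> B \<and> 4 \<in> B \<and>
      (5 \<in> B \<and> \<not> {3, 2} \<subseteq> B \<or> 5 \<notin> B \<and> 3 \<notin> B)}"
    "\<And>i j. i + j < ?m \<Longrightarrow> Q ! i \<inter> Y ! j \<noteq> {}"
    using kneser_staircase[OF dist(2) sub(2) q gr m] by blast
  have PQ: "distinct (P @ Q)"
  proof -
    have "set P \<inter> set Q = {}" using PX(5) QY(5) by fastforce
    then show ?thesis using PX(1) QY(1) by simp
  qed
  have XY: "distinct (X @ Y)"
  proof -
    \<comment> \<open>A common member would contain 2 and 4. Containing 4, it needs 3 to be in
      \<open>X\<close>; then \<open>Y\<close> requires 5 but forbids having both 2 and 3.\<close>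
    have "set X \<inter> set Y = {}" using PX(6) QY(6) by fastforce
    then show ?thesis using PX(2) QY(2) by simp
  qed
  have "bandwidth (kneser_verts n (q + 3)) (kneser_edges n (q + 3))
    \<le> (n choose (q + 3)) - Suc (((n - 1) choose (q + 3 - 1)) div 2 + ?m)"
    using PQ XY PX(3) QY(3) PX(4) QY(4)
  proof (rule bandwidth_kneser_le)
    show "set P \<union> set Q \<subseteq> {A \<in> kneser_verts n (q + 3). 1 \<in> A}"
      "set X \<union> set Y \<subseteq> {A \<in> kneser_verts n (q + 3). 1 \<notin> A}"
      using PX(5,6) QY(5,6) by auto
  qed (use PX(7) QY(7) gr3 n in auto)
  \<comment> \<open>Pascal's rule with a positive second summand shows that the subtraction above is
    not truncated.\<close>
  moreover have "n choose (q + 3) = ((n - 1) choose (q + 2)) + ((n - 1) choose (q + 3))"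
    using binomial_Suc_Suc[of "n - 1" "q + 2"] n by (simp add: numeral_eq_Suc)
  moreover have "0 < (n - 1) choose (q + 3)" using n by (simp add: zero_less_binomial_iff)
  moreover have "q + 3 - 1 = q + 2" "2 * ?m \<le> (n - 1) choose (q + 2)" using gr3 by simp_all
  ultimately show ?thesis by (simp only:) linarith
qed

theorem theorem3p2:
  fixes r :: nat
  assumes "r \<ge> 3"
  shows "\<exists>g \<in> O(\<lambda>n::nat. real n powi (int r - 4)).
           \<forall>\<^sub>F n in sequentially.
             real (bandwidth (kneser_verts n r) (kneser_edges n r))
               \<le> real (n choose r) - 1 / 2 * real ((n - 1) choose (r - 1))
                  - 2 * (real n ^ (r - 2) / fact (r - 2))
                  + real (r + 2) * (real n ^ (r - 3) / fact (r - 3))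
                  + g n"
proof -
  obtain q where r: "r = q + 3" using assms by (metis add.commute le_Suc_ex)
  \<comment> \<open>The error is taken to be exactly the main terms minus the true length, so its
    order is \<open>staircase_length_bigo\<close>.\<close>
  define g where "g n = 2 * (real n ^ Suc q / fact (Suc q)) - (real q + 5) * (real n ^ q / fact q) -
      real (staircase_length q n)" for n
  have "g \<in> O(\<lambda>n. real n powi (int r - 4))"
    using staircase_length_bigo[of q] by (simp add: g_def[abs_def] r)
  moreover have "\<forall>\<^sub>F n in sequentially.
             real (bandwidth (kneser_verts n r) (kneser_edges n r))
               \<le> real (n choose r) - 1 / 2 * real ((n - 1) choose (r - 1))
                  - 2 * (real n ^ (r - 2) / fact (r - 2))
                  + real (r + 2) * (real n ^ (r - 3) / fact (r - 3))
                  + g n"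
  proof (rule eventually_mono[OF eventually_ge_at_top[of "12 * q + 60"]])
    fix n assume n: "12 * q + 60 \<le> n"
    let ?B = "bandwidth (kneser_verts n r) (kneser_edges n r)"
    \<comment> \<open>After doubling, the \<open>Suc\<close> makes up for the rounding in
      \<open>div 2\<close>.\<close>
    have "2 * ?B + ((n - 1) choose (q + 2)) + 2 * staircase_length q n \<le> 2 * (n choose r)"
      using bandwidth_kneser_staircase[OF n] unfolding r by linarith
    from of_nat_mono[OF this, where 'a = real]
    have "2 * real ?B + real ((n - 1) choose (q + 2)) + 2 * real (staircase_length q n)
        \<le> 2 * real (n choose r)"
      by simp
    moreover have eqs: "r - 1 = q + 2" "r - 2 = Suc q" "r - 3 = q" "real (r + 2) = real q + 5"
      by (simp_all add: r)
    ultimately show "real ?B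
               \<le> real (n choose r) - 1 / 2 * real ((n - 1) choose (r - 1))
                  - 2 * (real n ^ (r - 2) / fact (r - 2))
                  + real (r + 2) * (real n ^ (r - 3) / fact (r - 3))
                  + g n"
      unfolding g_def eqs by linarith
  qed
  ultimately show ?thesis by blast
qed

end
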